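(* Let $n\ge 2$ and $D\ge 2$ be integers, let $\mathbb{F}$ be an arbitrary field, let $V_D\subseteq\mathbb{F}[s_1,\ldots,s_{n-1},u]$ be the $D$-th Veronese subring of the polynomial ring in $n$ variables, and let $P$ be one of the monomial prime ideals of $V_D$. When $P$ is nonzero and nonmaximal, for positive integers $E,r$ one has $$P^{(E)}\subseteq P^r\quad\text{if and only if}\quad r\le\lceil E/D\rceil.$$ In particular, $P^{(Dr)}\subseteq P^{(D(r-1)+1)}\subseteq P^r$ for all $r>0$, and the right-hand containment is sharp (the exponent $r$ on the right cannot be increased).
   Context: The $D$-th Veronese subring $V_D$ of a standard graded polynomial ring is the $\mathbb{F}$-subalgebra generated by all monomials of degree $D$ in the variables. A monomial ideal of $V_D$ is an ideal generated by monomials (in the variables) lying in $V_D$; a monomial prime is a monomial ideal that is prime. For a proper ideal $I$ in a nonzero Noetherian ring $A$ and an integer $a>0$, the $a$-th symbolic power is $I^{(a)}=\{f\in A: sf\in I^a\text{ for some }s\in W\}$, where $W=A\setminus\bigcup\{P: P\in\operatorname{Ass}_A(A/I)\}$. *)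

theory Defs
  imports
    "HOL-Algebra.Algebra"
    "HOL-Algebra.Algebraic_Closure_Type"
    "HOL-Library.Poly_Mapping"
begin

text \<open>
  Polynomials in the variables \<open>x\<^sub>0, x\<^sub>1, \<dots>\<close>. An exponent vector is a finitely supported function
  \<open>nat \<Rightarrow>\<^sub>0 nat\<close>; the product of the type is the convolution product from
  \<^theory>\<open>HOL-Library.Poly_Mapping\<close>. The paper's variables
  \<open>s\<^sub>1, \<dots>, s\<^sub>n\<^sub>-\<^sub>1, u\<close> are \<open>x\<^sub>0, \<dots>, x\<^sub>n\<^sub>-\<^sub>2, x\<^sub>n\<^sub>-\<^sub>1\<close>.
\<close>

type_synonym 'f mpolynomial = "(nat \<Rightarrow>\<^sub>0 nat) \<Rightarrow>\<^sub>0 'f"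

definition mpoly_ring :: "nat \<Rightarrow> ('f::field) mpolynomial ring" where
  "mpoly_ring n = ring_of_type_algebra
     \<lparr>carrier := {p. \<forall>m \<in> Poly_Mapping.keys p. Poly_Mapping.keys m \<subseteq> {..<n}}\<rparr>"

definition monom_deg :: "(nat \<Rightarrow>\<^sub>0 nat) \<Rightarrow> nat" where
  "monom_deg m = (\<Sum>i\<in>Poly_Mapping.keys m. Poly_Mapping.lookup m i)"

definition scalars :: "('f::field) mpolynomial set" where
  "scalars = range (Poly_Mapping.single 0)"

definition monomials :: "nat \<Rightarrow> ('f::field) mpolynomial set" where
  "monomials n = {Poly_Mapping.single m 1 | m. Poly_Mapping.keys m \<subseteq> {..<n}}"

definition monomials_of_degree :: "nat \<Rightarrow> nat \<Rightarrow> ('f::field) mpolynomial set" where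
  "monomials_of_degree n d =
     {Poly_Mapping.single m 1 | m. Poly_Mapping.keys m \<subseteq> {..<n} \<and> monom_deg m = d}"

text \<open>
  The subalgebra generated by a set of polynomials is the subring generated by that set
  together with the scalars.
\<close>

definition veronese :: "nat \<Rightarrow> nat \<Rightarrow> ('f::field) mpolynomial ring" where
  "veronese n D = (mpoly_ring n)
     \<lparr>carrier := generate_ring (mpoly_ring n) (scalars \<union> monomials_of_degree n D)\<rparr>"

definition monomial_ideal :: "nat \<Rightarrow> nat \<Rightarrow> ('f::field) mpolynomial set \<Rightarrow> bool" where
  "monomial_ideal n D I \<longleftrightarrow>
     (\<exists>M \<subseteq> monomials n \<inter> carrier (veronese n D). I = Idl\<^bsub>veronese n D\<^esub> M)"

definition monomial_prime :: "nat \<Rightarrow> nat \<Rightarrow> ('f::field) mpolynomial set \<Rightarrow> bool" where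
  "monomial_prime n D P \<longleftrightarrow> monomial_ideal n D P \<and> primeideal P (veronese n D)"

text \<open>
  \<open>associated_primes A I\<close> is the set of associated primes of the \<open>A\<close>-module \<open>A/I\<close>: the primes of
  \<open>A\<close> that are the annihilator of some element of \<open>A/I\<close>. An element \<open>x\<close> of \<open>A\<close> acts on \<open>A/I\<close> by
  multiplication with its class \<open>I + x\<close>.
\<close>

definition associated_primes :: "('a, 'b) ring_scheme \<Rightarrow> 'a set \<Rightarrow> 'a set set" where
  "associated_primes A I = {P. primeideal P A \<and>
     (\<exists>y \<in> carrier (A Quot I).
        P = {x \<in> carrier A. (I +>\<^bsub>A\<^esub> x) \<otimes>\<^bsub>A Quot I\<^esub> y = \<zero>\<^bsub>A Quot I\<^esub>})}"

text \<open>
  \<^const>\<open>ideals_set\<close> carries the product of ideals as its multiplication, so its powers are the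
  powers of ideals.
\<close>

definition ideal_pow :: "('a, 'b) ring_scheme \<Rightarrow> 'a set \<Rightarrow> nat \<Rightarrow> 'a set" where
  "ideal_pow A I r = I [^]\<^bsub>ideals_set A\<^esub> r"

text \<open>Meant for a proper ideal \<open>I\<close> of a nonzero Noetherian commutative ring \<open>A\<close> and \<open>a > 0\<close>.\<close>

definition symbolic_power :: "('a, 'b) ring_scheme \<Rightarrow> 'a set \<Rightarrow> nat \<Rightarrow> 'a set" where
  "symbolic_power A I a =
     {f \<in> carrier A. \<exists>s \<in> carrier A - \<Union>(associated_primes A I). s \<otimes>\<^bsub>A\<^esub> f \<in> ideal_pow A I a}"

end

theory Submission
  imports Defs
begin

text \<open>
  A nonzero nonmaximal monomial prime \<open>P\<close> is determined by the set \<open>T\<close> of those \<open>i\<close> with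
  \<open>x\<^sub>i\<^sup>D \<in> P\<close>, where \<open>T\<close> is neither empty nor all of \<open>{..<n}\<close>: a polynomial of the Veronese ring
  is in \<open>P\<close> iff each of its monomials has positive \<open>T\<close>-weight, the degree in the variables
  indexed by \<open>T\<close>. Then \<open>P\<^sup>r\<close> is spanned by the monomials of \<open>T\<close>-weight at least \<open>r\<close> and degree
  at least \<open>D r\<close>. Multiplying by a power of \<open>x\<^sub>j\<^sup>D\<close> with \<open>j \<notin> T\<close> removes the
  degree condition, so the symbolic power of exponent \<open>E\<close> is spanned by the monomials of \<open>T\<close>-weight at
  least \<open>E\<close>. A monomial of degree \<open>D d\<close> has weight at least \<open>E\<close> only if \<open>d \<ge> E / D\<close>, and a
  power of \<open>x\<^sub>i\<^sup>D\<close> with \<open>i \<in> T\<close> shows that this bound is attained up to rounding.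
\<close>

section \<open>Polynomials with prescribed support\<close>

text \<open>The rings, ideals and powers compared below are all spanned by monomials, so each is
  described by a set of exponents.\<close>

definition supported :: "'m set \<Rightarrow> ('m \<Rightarrow>\<^sub>0 'b::zero) set" where
  "supported A = {f. Poly_Mapping.keys f \<subseteq> A}"

lemma sum_single_lookup:
  fixes f :: "'m \<Rightarrow>\<^sub>0 'b::comm_monoid_add"
  shows "(\<Sum>m\<in>Poly_Mapping.keys f. Poly_Mapping.single m (Poly_Mapping.lookup f m)) = f"
proof (rule poly_mapping_eqI)
  fix k
  have "Poly_Mapping.lookup (\<Sum>m\<in>Poly_Mapping.keys f. Poly_Mapping.single m (Poly_Mapping.lookup f m)) k
      = (\<Sum>m\<in>Poly_Mapping.keys f. if m = k then Poly_Mapping.lookup f m else 0)"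
    by (auto simp: lookup_sum lookup_single when_def intro!: sum.cong)
  also have "\<dots> = Poly_Mapping.lookup f k"
    by (simp add: in_keys_iff)
  finally show "Poly_Mapping.lookup (\<Sum>m\<in>Poly_Mapping.keys f. Poly_Mapping.single m (Poly_Mapping.lookup f m)) k
      = Poly_Mapping.lookup f k" .
qed

text \<open>A polynomial is the sum of its terms, so membership in an additively closed set can be
  tested on single terms. This serves generated rings, ideals and ideal products alike.\<close>

lemma add_closed_memI:
  fixes f :: "'m \<Rightarrow>\<^sub>0 'b::comm_monoid_add"
  assumes zero: "0 \<in> Z" and add: "\<And>g h. g \<in> Z \<Longrightarrow> h \<in> Z \<Longrightarrow> g + h \<in> Z"
    and single: "\<And>m. m \<in> Poly_Mapping.keys f \<Longrightarrow>
      Poly_Mapping.single m (Poly_Mapping.lookup f m) \<in> Z"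
  shows "f \<in> Z"
proof -
  have "(\<Sum>m\<in>F. g m) \<in> Z" if "finite F" "\<And>m. m \<in> F \<Longrightarrow> g m \<in> Z"
    for F and g :: "'m \<Rightarrow> 'm \<Rightarrow>\<^sub>0 'b"
    using that by (induction F rule: finite_induct) (auto intro: zero add)
  then show ?thesis
    using single sum_single_lookup[of f] by (metis finite_keys)
qed

lemma supported_zero: "0 \<in> supported A"
  by (simp add: supported_def)

lemma supported_add: "f \<in> supported A \<Longrightarrow> g \<in> supported A \<Longrightarrow> f + g \<in> supported A"
  using keys_add[of f g] by (auto simp: supported_def)

lemma supported_uminus:
  fixes f :: "'m \<Rightarrow>\<^sub>0 'b::ab_group_add"
  shows "f \<in> supported A \<Longrightarrow> - f \<in> supported A"
  by (auto simp: supported_def in_keys_iff)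

lemma supported_mult:
  assumes "f \<in> supported A" "g \<in> supported B" "\<And>a b. a \<in> A \<Longrightarrow> b \<in> B \<Longrightarrow> a + b \<in> C"
  shows "f * g \<in> supported C"
  using assms keys_mult[of f g] by (fastforce simp: supported_def)

lemma supported_single: "Poly_Mapping.single m c \<in> supported A \<longleftrightarrow> m \<in> A \<or> c = 0"
  by (auto simp: supported_def)

text \<open>The components of lowest weight of the two factors multiply to a nonzero component of the
  product, because the polynomial ring is a domain.\<close>

lemma exists_key_mult_of_least_weight:
  fixes f g :: "'m::{ordered_cancel_comm_monoid_add,linorder} \<Rightarrow>\<^sub>0 'b::semiring_no_zero_divisors"
    and w :: "'m \<Rightarrow> nat"
  assumes w_add: "\<And>a b. w (a + b) = w a + w b"
    and f: "\<exists>m \<in> Poly_Mapping.keys f. w m = i" "\<And>m. m \<in> Poly_Mapping.keys f \<Longrightarrow> w m \<ge> i"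
    and g: "\<exists>m \<in> Poly_Mapping.keys g. w m = j" "\<And>m. m \<in> Poly_Mapping.keys g \<Longrightarrow> w m \<ge> j"
  shows "\<exists>m \<in> Poly_Mapping.keys (f * g). w m = i + j"
proof -
  have split: "\<exists>h0 h1. h = h0 + h1 \<and> h0 \<noteq> 0 \<and> h0 \<in> supported {m. w m = k} \<and>
      h1 \<in> supported {m. w m > k}"
    if h: "\<exists>m \<in> Poly_Mapping.keys h. w m = k" "\<And>m. m \<in> Poly_Mapping.keys h \<Longrightarrow> w m \<ge> k"
    for h :: "'m \<Rightarrow>\<^sub>0 'b" and k
  proof -
    let ?s = "\<lambda>m. Poly_Mapping.single m (Poly_Mapping.lookup h m)"
    let ?K = "{m \<in> Poly_Mapping.keys h. w m = k}"
    let ?L = "{m \<in> Poly_Mapping.keys h. w m > k}"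
    have in_supp: "(\<Sum>m\<in>F. ?s m) \<in> supported B" if "finite F" "F \<subseteq> B" for F B
      using that
      by (induction F rule: finite_induct)
        (auto simp: supported_zero supported_single intro!: supported_add)
    have "Poly_Mapping.keys h = ?K \<union> ?L"
      using h(2) by (auto simp: order.order_iff_strict)
    then have eq: "h = sum ?s ?K + sum ?s ?L"
      using sum.union_disjoint[of ?K ?L ?s] sum_single_lookup[of h] by force
    obtain m where m: "m \<in> Poly_Mapping.keys h" "w m = k"
      using h(1) by blast
    have L: "sum ?s ?L \<in> supported {m. w m > k}"
      by (rule in_supp) auto
    then have "sum ?s ?K \<noteq> 0"
      using m eq by (metis (no_types, lifting) add_0 less_irrefl mem_Collect_eq subsetD supported_def)
    moreover have "sum ?s ?K \<in> supported {m. w m = k}"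
      by (rule in_supp) auto
    ultimately show ?thesis
      using eq L by blast
  qed
  obtain f0 f1 where f01: "f = f0 + f1" "f0 \<noteq> 0" "f0 \<in> supported {m. w m = i}"
      "f1 \<in> supported {m. w m > i}"
    using split[OF f] by blast
  obtain g0 g1 where g01: "g = g0 + g1" "g0 \<noteq> 0" "g0 \<in> supported {m. w m = j}"
      "g1 \<in> supported {m. w m > j}"
    using split[OF g] by blast
  have eq: "f * g = f0 * g0 + (f0 * g1 + (f1 * g0 + f1 * g1))"
    by (simp add: f01(1) g01(1) algebra_simps)
  have "f0 * g0 \<noteq> 0"
    using f01(2) g01(2) by simp
  then obtain m where m: "m \<in> Poly_Mapping.keys (f0 * g0)"
    by (metis ex_in_conv keys_eq_empty)
  have wm: "w m = i + j"
    using m supported_mult[OF f01(3) g01(3), of "{m. w m = i + j}"]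
    by (auto simp: supported_def w_add)
  \<comment> \<open>The three remaining products only have weights above \<open>i + j\<close>, so
    they cannot cancel the monomial \<open>m\<close> of \<open>f0 * g0\<close>.\<close>
  have "f0 * g1 + (f1 * g0 + f1 * g1) \<in> supported {m. w m > i + j}"
    by (intro supported_add supported_mult[OF f01(3) g01(4)] supported_mult[OF f01(4) g01(3)]
        supported_mult[OF f01(4) g01(4)]) (auto simp: w_add)
  then have "Poly_Mapping.lookup (f0 * g1 + (f1 * g0 + f1 * g1)) m = 0"
    using wm by (auto simp: supported_def in_keys_iff)
  then have "m \<in> Poly_Mapping.keys (f * g)"
    using m by (simp add: eq in_keys_iff lookup_add)
  then show ?thesis
    using wm by blast
qed

section \<open>Weights and factorizations of exponents\<close>

text \<open>Intersecting with the keys keeps the sum finite for infinite \<open>S\<close>, such as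
  \<open>UNIV\<close>, which gives the total degree, or a complement.\<close>

definition weight :: "nat set \<Rightarrow> (nat \<Rightarrow>\<^sub>0 nat) \<Rightarrow> nat" where
  "weight S m = (\<Sum>i\<in>Poly_Mapping.keys m \<inter> S. Poly_Mapping.lookup m i)"

lemma monom_deg_eq_weight: "monom_deg m = weight UNIV m"
  by (simp add: monom_deg_def weight_def)

lemma weight_superset:
  assumes "finite F" "Poly_Mapping.keys m \<subseteq> F"
  shows "weight S m = (\<Sum>i\<in>F \<inter> S. Poly_Mapping.lookup m i)"
  unfolding weight_def using assms
  by (intro sum.mono_neutral_left) (auto simp: in_keys_iff)

lemma weight_add [simp]: "weight S (a + b) = weight S a + weight S b"
proof -
  let ?F = "Poly_Mapping.keys a \<union> Poly_Mapping.keys b"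
  have "Poly_Mapping.keys (a + b) \<subseteq> ?F"
    by (rule keys_add)
  then show ?thesis
    by (simp add: weight_superset[of ?F] lookup_add sum.distrib)
qed

lemma weight_zero [simp]: "weight S 0 = 0"
  by (simp add: weight_def)

lemma weight_single [simp]: "weight S (Poly_Mapping.single i k) = (if i \<in> S then k else 0)"
  by (auto simp: weight_def)

lemma monom_deg_add [simp]: "monom_deg (a + b) = monom_deg a + monom_deg b"
  by (simp add: monom_deg_eq_weight)

lemma monom_deg_single [simp]: "monom_deg (Poly_Mapping.single i k) = k"
  by (simp add: monom_deg_eq_weight)

lemma monom_deg_zero [simp]: "monom_deg 0 = 0"
  by (simp add: monom_deg_eq_weight)

lemma monom_deg_split: "monom_deg m = weight S m + weight (- S) m"
proof -
  have "Poly_Mapping.keys m = (Poly_Mapping.keys m \<inter> S) \<union> (Poly_Mapping.keys m \<inter> - S)"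
    by auto
  then have "monom_deg m = (\<Sum>i\<in>(Poly_Mapping.keys m \<inter> S) \<union> (Poly_Mapping.keys m \<inter> - S).
      Poly_Mapping.lookup m i)"
    by (simp add: monom_deg_def)
  also have "\<dots> = weight S m + weight (- S) m"
    unfolding weight_def by (intro sum.union_disjoint) auto
  finally show ?thesis .
qed

lemma weight_pos_iff: "weight S m > 0 \<longleftrightarrow> Poly_Mapping.keys m \<inter> S \<noteq> {}"
proof -
  have "weight S m = 0 \<longleftrightarrow> Poly_Mapping.keys m \<inter> S = {}"
    unfolding weight_def by (subst sum_eq_0_iff) (auto simp: in_keys_iff)
  then show ?thesis
    using gr0_conv_Suc gr_zeroI by auto
qed

lemma monom_deg_eq_0_iff: "monom_deg m = 0 \<longleftrightarrow> m = 0"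
  by (metis Int_UNIV_right bot_nat_0.not_eq_extremum keys_eq_empty monom_deg_eq_weight weight_pos_iff)

lemma keys_add_nat: "Poly_Mapping.keys (a + b) = Poly_Mapping.keys a \<union> Poly_Mapping.keys b"
  for a b :: "'a \<Rightarrow>\<^sub>0 nat"
  by (auto simp: in_keys_iff lookup_add)

lemma exists_single_add:
  fixes m :: "'a \<Rightarrow>\<^sub>0 nat"
  assumes "i \<in> Poly_Mapping.keys m"
  shows "\<exists>b. m = Poly_Mapping.single i 1 + b"
proof
  show "m = Poly_Mapping.single i 1 + (m - Poly_Mapping.single i 1)"
    using assms
    by (intro poly_mapping_eqI) (auto simp: lookup_add lookup_minus lookup_single when_def in_keys_iff)
qed

text \<open>While the factor \<open>a\<close> has weight below that of \<open>m\<close>, the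
  cofactor still involves a variable from \<open>S\<close>, and one copy of it can be moved to
  \<open>a\<close>.\<close>

lemma exists_factor_of_weight:
  "k \<le> weight S m \<Longrightarrow> \<exists>a b. m = a + b \<and> weight S a = k \<and> weight (- S) a = 0"
proof (induction k)
  case 0
  show ?case
    by (rule exI[of _ 0], rule exI[of _ m]) simp
next
  case (Suc k)
  then obtain a b where ab: "m = a + b" "weight S a = k" "weight (- S) a = 0"
    by auto
  then have "weight S b > 0"
    using Suc.prems by simp
  then obtain i where i: "i \<in> Poly_Mapping.keys b" "i \<in> S"
    by (auto simp: weight_pos_iff)
  obtain c where "b = Poly_Mapping.single i 1 + c"
    using exists_single_add[OF i(1)] ..
  then show ?case
    using ab i by (intro exI[of _ "a + Poly_Mapping.single i 1"] exI[of _ c]) (auto simp: add.assoc)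
qed

text \<open>A part of weight \<open>k\<close> is taken from the variables in \<open>S\<close>, then
  a part of weight \<open>l\<close> from the others. The first part has no variable outside
  \<open>S\<close>, so its cofactor keeps all the weight that the second needs.\<close>

lemma exists_factor:
  assumes "k \<le> weight S m" "l \<le> weight (- S) m"
  shows "\<exists>a b. m = a + b \<and> weight S a = k \<and> monom_deg a = k + l"
proof -
  obtain a b where ab: "m = a + b" "weight S a = k" "weight (- S) a = 0"
    using exists_factor_of_weight[OF assms(1)] by blast
  then have "l \<le> weight (- S) b"
    using assms(2) by simp
  then obtain c d where cd: "b = c + d" "weight (- S) c = l" "weight S c = 0"
    using exists_factor_of_weight[of l "- S" b] by auto
  then show ?thesis
    using ab by (intro exI[of _ "a + c"] exI[of _ d]) (auto simp: add.assoc monom_deg_split[of _ S])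
qed

section \<open>Monoid algebras\<close>

text \<open>For a submonoid \<open>A\<close> of the exponents this is the monoid algebra of
  \<open>A\<close>.\<close>

definition poly_subring :: "'m set \<Rightarrow> ('m::comm_monoid_add \<Rightarrow>\<^sub>0 'b::comm_ring_1) ring" where
  "poly_subring A = ring_of_type_algebra\<lparr>carrier := supported A\<rparr>"

lemma poly_subring_simps [simp]:
  "carrier (poly_subring A) = supported A"
  "x \<otimes>\<^bsub>poly_subring A\<^esub> y = x * y"
  "x \<oplus>\<^bsub>poly_subring A\<^esub> y = x + y"
  "\<one>\<^bsub>poly_subring A\<^esub> = 1"
  "\<zero>\<^bsub>poly_subring A\<^esub> = 0"
  by (simp_all add: poly_subring_def ring_of_type_algebra_def)

lemma cring_poly_subring:
  assumes "0 \<in> A" "\<And>a b. a \<in> A \<Longrightarrow> b \<in> A \<Longrightarrow> a + b \<in> A"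
  shows "cring (poly_subring A :: ('m::comm_monoid_add \<Rightarrow>\<^sub>0 'b::comm_ring_1) ring)"
proof (rule cringI)
  let ?R = "poly_subring A :: ('m \<Rightarrow>\<^sub>0 'b) ring"
  have one: "(1 :: 'm \<Rightarrow>\<^sub>0 'b) \<in> supported A"
    using assms(1) by (simp add: supported_def)
  have mult: "x * y \<in> supported A" if "x \<in> supported A" "y \<in> supported A" for x y :: "'m \<Rightarrow>\<^sub>0 'b"
    using that assms(2) by (rule supported_mult)
  show "abelian_group ?R"
    by (rule abelian_groupI)
      (auto simp: supported_add supported_zero algebra_simps
        intro!: bexI[of _ "- x" for x] supported_uminus)
  show "comm_monoid ?R"
    by (rule comm_monoidI) (auto simp: one mult algebra_simps)
qed (auto simp: algebra_simps)

lemma poly_subring_minus: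
  fixes x :: "'m::comm_monoid_add \<Rightarrow>\<^sub>0 'b::comm_ring_1"
  assumes "0 \<in> A" "\<And>a b. a \<in> A \<Longrightarrow> b \<in> A \<Longrightarrow> a + b \<in> A" "x \<in> supported A"
  shows "\<ominus>\<^bsub>poly_subring A\<^esub> x = - x"
proof -
  interpret cring "poly_subring A :: ('m \<Rightarrow>\<^sub>0 'b) ring"
    using assms(1,2) by (rule cring_poly_subring)
  show ?thesis
    by (rule minus_equality) (auto simp: assms(3) supported_uminus)
qed

lemma subring_supported:
  assumes "0 \<in> A" "\<And>a b. a \<in> A \<Longrightarrow> b \<in> A \<Longrightarrow> a + b \<in> A"
    and "0 \<in> B" "\<And>a b. a \<in> B \<Longrightarrow> b \<in> B \<Longrightarrow> a + b \<in> B" "B \<subseteq> A"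
  shows "subring (supported B) (poly_subring A :: ('m::comm_monoid_add \<Rightarrow>\<^sub>0 'b::comm_ring_1) ring)"
proof -
  interpret cring "poly_subring A :: ('m \<Rightarrow>\<^sub>0 'b) ring"
    using assms(1,2) by (rule cring_poly_subring)
  have sub: "supported B \<subseteq> (supported A :: ('m \<Rightarrow>\<^sub>0 'b) set)"
    using \<open>B \<subseteq> A\<close> by (auto simp: supported_def)
  show ?thesis
  proof (rule subringI)
    show "\<one>\<^bsub>poly_subring A\<^esub> \<in> (supported B :: ('m \<Rightarrow>\<^sub>0 'b) set)"
      using assms(3) by (simp add: supported_def)
    show "\<ominus>\<^bsub>poly_subring A\<^esub> x \<in> supported B" if "x \<in> supported B" for x :: "'m \<Rightarrow>\<^sub>0 'b"
      using that sub assms(1,2) by (auto simp: poly_subring_minus supported_uminus)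
    show "x \<otimes>\<^bsub>poly_subring A\<^esub> y \<in> supported B" if "x \<in> supported B" "y \<in> supported B"
      for x y :: "'m \<Rightarrow>\<^sub>0 'b"
      using supported_mult[OF that assms(4)] by simp
  qed (use sub in \<open>auto simp: supported_add\<close>)
qed

text \<open>\<open>B\<close> is an ideal of the monoid \<open>A\<close>, so products of ring
  elements with polynomials supported on \<open>B\<close> are again supported on
  \<open>B\<close>.\<close>

lemma ideal_supported:
  assumes "0 \<in> A" "\<And>a b. a \<in> A \<Longrightarrow> b \<in> A \<Longrightarrow> a + b \<in> A"
    and "B \<subseteq> A" "\<And>a b. a \<in> A \<Longrightarrow> b \<in> B \<Longrightarrow> a + b \<in> B"
  shows "ideal (supported B) (poly_subring A :: ('m::comm_monoid_add \<Rightarrow>\<^sub>0 'b::comm_ring_1) ring)"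
proof -
  interpret cring "poly_subring A :: ('m \<Rightarrow>\<^sub>0 'b) ring"
    using assms(1,2) by (rule cring_poly_subring)
  have sub: "supported B \<subseteq> (supported A :: ('m \<Rightarrow>\<^sub>0 'b) set)"
    using \<open>B \<subseteq> A\<close> by (auto simp: supported_def)
  have mult: "x * y \<in> supported B" if "x \<in> supported A" "y \<in> supported B" for x y :: "'m \<Rightarrow>\<^sub>0 'b"
    using that assms(4) by (rule supported_mult)
  show ?thesis
  proof (rule idealI[OF ring_axioms])
    show "subgroup (supported B) (add_monoid (poly_subring A :: ('m \<Rightarrow>\<^sub>0 'b) ring))"
    proof (rule subgroup.intro)
      show "inv\<^bsub>add_monoid (poly_subring A)\<^esub> x \<in> supported B" if "x \<in> supported B"
        for x :: "'m \<Rightarrow>\<^sub>0 'b"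
      proof -
        have "x \<in> supported A"
          using that sub by blast
        then show ?thesis
          using poly_subring_minus[OF assms(1,2), of x] supported_uminus[OF that]
          by (simp only: a_inv_def)
      qed
    qed (use sub in \<open>auto simp: supported_add supported_zero\<close>)
    show "x \<otimes>\<^bsub>poly_subring A\<^esub> y \<in> supported B" "y \<otimes>\<^bsub>poly_subring A\<^esub> x \<in> supported B"
      if "y \<in> supported B" "x \<in> carrier (poly_subring A)" for x y :: "'m \<Rightarrow>\<^sub>0 'b"
      using mult[of x y] that by (simp_all add: mult.commute)
  qed
qed

section \<open>Explicit form of the Veronese ring\<close>

definition veronese_exponents :: "nat \<Rightarrow> nat \<Rightarrow> (nat \<Rightarrow>\<^sub>0 nat) set" where
  "veronese_exponents n D = {m. Poly_Mapping.keys m \<subseteq> {..<n} \<and> D dvd monom_deg m}"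

lemma veronese_exponents_zero: "0 \<in> veronese_exponents n D"
  by (simp add: veronese_exponents_def)

lemma veronese_exponents_add:
  "a \<in> veronese_exponents n D \<Longrightarrow> b \<in> veronese_exponents n D \<Longrightarrow> a + b \<in> veronese_exponents n D"
  by (auto simp: veronese_exponents_def keys_add_nat)

lemma mpoly_ring_eq:
  "(mpoly_ring n :: ('a::field) mpolynomial ring) = poly_subring {m. Poly_Mapping.keys m \<subseteq> {..<n}}"
proof -
  have "{p :: 'a mpolynomial. \<forall>m \<in> Poly_Mapping.keys p. Poly_Mapping.keys m \<subseteq> {..<n}}
      = supported {m. Poly_Mapping.keys m \<subseteq> {..<n}}"
    unfolding supported_def by blast
  then show ?thesis
    by (simp only: mpoly_ring_def poly_subring_def)
qed

text \<open>Factors of degree \<open>D\<close> are split off one at a time. The coefficient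
  \<open>c\<close> stays with the cofactor until the exponent is zero, where it is a scalar and
  hence a generator.\<close>

lemma single_in_generate_ring:
  fixes c :: "'f::field"
  assumes "D > 0" "monom_deg m = D * d" "Poly_Mapping.keys m \<subseteq> {..<n}"
  shows "Poly_Mapping.single m c \<in>
    generate_ring (mpoly_ring n) (scalars \<union> monomials_of_degree n D)"
  using assms(2,3)
proof (induction d arbitrary: m)
  case 0
  then have "m = 0"
    by (simp add: monom_deg_eq_0_iff)
  then show ?case
    by (auto intro: generate_ring.incl simp: scalars_def)
next
  case (Suc d)
  obtain a b where ab: "m = a + b" "monom_deg a = D"
    using exists_factor[of D UNIV m 0] Suc.prems by (auto simp: monom_deg_eq_weight)
  then have "Poly_Mapping.single b c \<in>
      generate_ring (mpoly_ring n) (scalars \<union> monomials_of_degree n D)"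
    using Suc by (auto simp: keys_add_nat)
  moreover have "Poly_Mapping.single a 1 \<in>
      generate_ring (mpoly_ring n) (scalars \<union> monomials_of_degree n D :: 'f mpolynomial set)"
    using ab Suc.prems
    by (intro generate_ring.incl) (auto simp: monomials_of_degree_def keys_add_nat)
  ultimately have "Poly_Mapping.single a 1 \<otimes>\<^bsub>mpoly_ring n\<^esub> Poly_Mapping.single b c \<in>
      generate_ring (mpoly_ring n) (scalars \<union> monomials_of_degree n D)"
    by (rule generate_ring.eng_mult[rotated])
  then show ?case
    by (simp add: mpoly_ring_eq mult_single ab(1))
qed

text \<open>The generators have degree \<open>0\<close> or \<open>D\<close>, so the generated ring
  stays within degrees divisible by \<open>D\<close>; conversely each term of such a degree is a
  product of generators.\<close>

lemma veronese_eq: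
  assumes "D > 0"
  shows "(veronese n D :: ('f::field) mpolynomial ring) = poly_subring (veronese_exponents n D)"
proof -
  let ?H = "scalars \<union> monomials_of_degree n D :: 'f mpolynomial set"
  let ?B = "{m :: nat \<Rightarrow>\<^sub>0 nat. Poly_Mapping.keys m \<subseteq> {..<n}}"
  have B: "0 \<in> ?B" "\<And>a b. a \<in> ?B \<Longrightarrow> b \<in> ?B \<Longrightarrow> a + b \<in> ?B"
    by (auto simp: keys_add_nat)
  interpret cring "mpoly_ring n :: 'f mpolynomial ring"
    unfolding mpoly_ring_eq using B by (rule cring_poly_subring)
  have "generate_ring (mpoly_ring n) ?H = supported (veronese_exponents n D)"
  proof
    show "generate_ring (mpoly_ring n) ?H \<subseteq> supported (veronese_exponents n D)"
    proof (rule generate_ring_min_subring1)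
      show "?H \<subseteq> carrier (mpoly_ring n)"
        by (auto simp: mpoly_ring_eq scalars_def monomials_of_degree_def supported_single)
      show "subring (supported (veronese_exponents n D)) (mpoly_ring n :: 'f mpolynomial ring)"
        unfolding mpoly_ring_eq using B veronese_exponents_zero veronese_exponents_add
        by (rule subring_supported) (auto simp: veronese_exponents_def)
      show "?H \<subseteq> supported (veronese_exponents n D)"
        by (auto simp: scalars_def monomials_of_degree_def supported_single veronese_exponents_def)
    qed
    show "supported (veronese_exponents n D) \<subseteq> generate_ring (mpoly_ring n) ?H"
    proof
      fix f :: "'f mpolynomial"
      assume f: "f \<in> supported (veronese_exponents n D)"
      show "f \<in> generate_ring (mpoly_ring n) ?H"
      proof (rule add_closed_memI)
        show "0 \<in> generate_ring (mpoly_ring n) ?H"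
          using zero_in_generate[of ?H] by (simp add: mpoly_ring_eq)
        show "g + h \<in> generate_ring (mpoly_ring n) ?H"
          if "g \<in> generate_ring (mpoly_ring n) ?H" "h \<in> generate_ring (mpoly_ring n) ?H" for g h
          using generate_ring.eng_add[OF that] by (simp add: mpoly_ring_eq)
        show "Poly_Mapping.single m (Poly_Mapping.lookup f m) \<in> generate_ring (mpoly_ring n) ?H"
          if "m \<in> Poly_Mapping.keys f" for m
        proof -
          have "m \<in> veronese_exponents n D"
            using f that by (auto simp: supported_def)
          then obtain d where "monom_deg m = D * d" "Poly_Mapping.keys m \<subseteq> {..<n}"
            by (auto simp: veronese_exponents_def)
          with assms show ?thesis
            by (rule single_in_generate_ring)
        qed
      qed
    qed
  qed
  then show ?thesis
    by (simp add: veronese_def poly_subring_def mpoly_ring_eq)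
qed

section \<open>Associated primes and powers of ideals\<close>

lemma primeideal_one_notin:
  assumes "primeideal P R"
  shows "\<one>\<^bsub>R\<^esub> \<notin> P"
proof -
  interpret primeideal P R by fact
  show ?thesis
    using I_notcarr one_imp_carrier by blast
qed

lemma associated_primes_primeideal:
  assumes "primeideal P R"
  shows "associated_primes R P = {P}"
proof -
  interpret primeideal P R by fact
  have carrier_Quot: "carrier (R Quot P) = {P +>\<^bsub>R\<^esub> a | a. a \<in> carrier R}"
    by (auto simp: FactRing_simps)
  have ann: "(P +>\<^bsub>R\<^esub> x) \<otimes>\<^bsub>R Quot P\<^esub> (P +>\<^bsub>R\<^esub> a) = \<zero>\<^bsub>R Quot P\<^esub> \<longleftrightarrow> x \<otimes>\<^bsub>R\<^esub> a \<in> P"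
    if "x \<in> carrier R" "a \<in> carrier R" for x a
  proof -
    have "P +>\<^bsub>R\<^esub> y = P \<longleftrightarrow> y \<in> P" if "y \<in> carrier R" for y
      using that by (metis a_coset_join1 a_coset_join2 a_subgroup is_additive_subgroup)
    then show ?thesis
      using that by (simp add: FactRing_def rcoset_mult_add)
  qed
  have annset: "{x \<in> carrier R. (P +>\<^bsub>R\<^esub> x) \<otimes>\<^bsub>R Quot P\<^esub> (P +>\<^bsub>R\<^esub> a) = \<zero>\<^bsub>R Quot P\<^esub>}
      = (if a \<in> P then carrier R else P)" if "a \<in> carrier R" for a
  proof -
    have "{x \<in> carrier R. (P +>\<^bsub>R\<^esub> x) \<otimes>\<^bsub>R Quot P\<^esub> (P +>\<^bsub>R\<^esub> a) = \<zero>\<^bsub>R Quot P\<^esub>}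
        = {x \<in> carrier R. x \<otimes>\<^bsub>R\<^esub> a \<in> P}"
      using ann that by blast
    also have "\<dots> = (if a \<in> P then carrier R else P)"
      using that I_prime I_l_closed I_r_closed Icarr by auto
    finally show ?thesis .
  qed
  show ?thesis
  proof (intro equalityI subsetI)
    fix Q
    assume "Q \<in> associated_primes R P"
    then obtain a where "primeideal Q R" "a \<in> carrier R" "Q = (if a \<in> P then carrier R else P)"
      using annset by (auto simp: associated_primes_def carrier_Quot)
    then show "Q \<in> {P}"
      using primeideal.I_notcarr by (auto split: if_splits)
  next
    fix Q
    assume "Q \<in> {P}"
    moreover have "\<one>\<^bsub>R\<^esub> \<notin> P"
      using assms by (rule primeideal_one_notin)
    ultimately show "Q \<in> associated_primes R P"
      using annset[of "\<one>\<^bsub>R\<^esub>"] primeideal_axioms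
      by (auto simp: associated_primes_def carrier_Quot intro!: exI[of _ "P +>\<^bsub>R\<^esub> \<one>\<^bsub>R\<^esub>"])
  qed
qed

lemma ideal_pow_0: "ideal_pow R I 0 = carrier R"
  by (simp add: ideal_pow_def ideals_set_def nat_pow_def)

lemma ideal_pow_Suc: "ideal_pow R I (Suc r) = ideal_prod R (ideal_pow R I r) I"
  by (simp add: ideal_pow_def ideals_set_def nat_pow_def)

section \<open>Monomial primes\<close>

lemma sum_const_single: "(\<Sum>_<k. Poly_Mapping.single i 1) = Poly_Mapping.single i (k::nat)"
  by (induction k) (auto simp flip: single_add simp del: sum_constant)

lemma sum_const_exponents:
  assumes "m \<in> veronese_exponents n D"
  shows "(\<Sum>_<k::nat. m) \<in> veronese_exponents n D"
  by (induction k)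
    (auto simp: veronese_exponents_zero veronese_exponents_add assms simp del: sum_constant)

text \<open>The degree of the sum is \<open>D\<close> times that of \<open>m\<close>, hence
  divisible by \<open>D\<close> whatever the degree of \<open>m\<close> is.\<close>

lemma sum_D_const_exponents:
  assumes "Poly_Mapping.keys m \<subseteq> {..<n}"
  shows "(\<Sum>_<D. m) \<in> veronese_exponents n D"
proof -
  have "Poly_Mapping.keys (\<Sum>_<k. m) \<subseteq> {..<n} \<and> monom_deg (\<Sum>_<k. m) = k * monom_deg m" for k :: nat
    by (induction k) (use assms in \<open>auto simp: keys_add_nat simp del: sum_constant\<close>)
  then show ?thesis
    by (simp add: veronese_exponents_def del: sum_constant)
qed

text \<open>Sums of \<open>D\<close> equal exponents are the exponents of \<open>D\<close>-th powers: the \<open>D\<close>-th power of any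
  monomial is a product of the elements \<open>x\<^sub>i\<^sup>D\<close> of the Veronese ring, so a prime sees only which of
  these it contains.\<close>

lemma primeideal_monomial_iff:
  fixes P :: "('f::field) mpolynomial set"
  assumes "D > 0" and prime: "primeideal P (poly_subring (veronese_exponents n D))"
    and m: "m \<in> veronese_exponents n D"
  shows "Poly_Mapping.single m 1 \<in> P \<longleftrightarrow>
    weight {i. i < n \<and> Poly_Mapping.single (Poly_Mapping.single i D) 1 \<in> P} m > 0"
proof -
  let ?T = "{i. i < n \<and> Poly_Mapping.single (Poly_Mapping.single i D) 1 \<in> P}"
  let ?A = "veronese_exponents n D"
  interpret primeideal P "poly_subring ?A" by (rule prime)
  have one: "Poly_Mapping.single 0 1 \<notin> P"
    using primeideal_one_notin[OF prime] by simp
  have mult: "Poly_Mapping.single (a + b) 1 \<in> P \<longleftrightarrow>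
      Poly_Mapping.single a 1 \<in> P \<or> Poly_Mapping.single b 1 \<in> P" if "a \<in> ?A" "b \<in> ?A" for a b
    using that I_prime[of "Poly_Mapping.single a 1" "Poly_Mapping.single b 1"]
      I_l_closed[of "Poly_Mapping.single b 1" "Poly_Mapping.single a 1"]
      I_r_closed[of "Poly_Mapping.single a 1" "Poly_Mapping.single b 1"]
    by (auto simp: supported_single mult_single)
  have power: "Poly_Mapping.single (\<Sum>_<k. m) 1 \<in> P \<longleftrightarrow> k > 0 \<and> Poly_Mapping.single m 1 \<in> P"
    for k :: nat
    using one m by (induction k) (auto simp: mult sum_const_exponents simp del: sum_constant)
  \<comment> \<open>The induction removes one variable at a time, so its exponents \<open>l\<close>
    need not have degree divisible by \<open>D\<close>; only their \<open>D\<close>-fold sums are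
    sure to lie in \<open>?A\<close>.\<close>
  have "Poly_Mapping.single (\<Sum>_<D. l) 1 \<in> P \<longleftrightarrow> weight ?T l > 0"
    if "Poly_Mapping.keys l \<subseteq> {..<n}" for l
    using that
  proof (induction "monom_deg l" arbitrary: l)
    case 0
    then have "l = 0"
      by (simp add: monom_deg_eq_0_iff)
    then show ?case
      using one by simp
  next
    case (Suc d)
    then obtain i where i: "i \<in> Poly_Mapping.keys l"
      by (metis Suc_neq_Zero ex_in_conv keys_eq_empty monom_deg_eq_0_iff)
    obtain b where b: "l = Poly_Mapping.single i 1 + b"
      using exists_single_add[OF i] ..
    have keys: "i < n" "Poly_Mapping.keys b \<subseteq> {..<n}"
      using Suc.prems by (auto simp: b keys_add_nat)
    have "(\<Sum>_<D. l) = Poly_Mapping.single i D + (\<Sum>_<D. b)"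
      unfolding b by (subst sum.distrib) (simp only: sum_const_single)
    moreover have "Poly_Mapping.single i D \<in> ?A"
      using keys \<open>D > 0\<close> by (simp add: veronese_exponents_def)
    moreover have "Poly_Mapping.single (\<Sum>_<D. b) 1 \<in> P \<longleftrightarrow> weight ?T b > 0"
      using Suc.hyps(2) keys by (intro Suc.hyps(1)) (auto simp: b)
    ultimately show ?case
      using keys sum_D_const_exponents[OF keys(2), of D]
      by (auto simp: mult b simp del: sum_constant)
  qed
  then show ?thesis
    using power[of D] m \<open>D > 0\<close> by (simp add: veronese_exponents_def del: sum_constant)
qed

text \<open>Both inclusions are checked on monomials: on the generators \<open>M\<close> in one
  direction, on the terms of \<open>f\<close> in the other. An empty \<open>T\<close> gives the zero
  ideal, and \<open>T = {..<n}\<close> a maximal ideal.\<close>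

lemma monomial_prime_eq:
  fixes P :: "('f::field) mpolynomial set"
  assumes "D > 0" and P: "monomial_prime n D P"
  obtains T where "P = supported {m \<in> veronese_exponents n D. weight T m > 0}" "T \<subseteq> {..<n}"
proof
  let ?T = "{i. i < n \<and> Poly_Mapping.single (Poly_Mapping.single i D) 1 \<in> P}"
  let ?A = "veronese_exponents n D"
  let ?B = "{m \<in> ?A. weight ?T m > 0}"
  let ?V = "poly_subring ?A :: 'f mpolynomial ring"
  have prime: "primeideal P ?V"
    using assms by (simp add: monomial_prime_def veronese_eq)
  interpret primeideal P ?V by (rule prime)
  obtain M where M: "M \<subseteq> monomials n" "M \<subseteq> carrier ?V" "P = Idl\<^bsub>?V\<^esub> M"
    using assms by (auto simp: monomial_prime_def monomial_ideal_def veronese_eq)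
  note iff = primeideal_monomial_iff[OF \<open>D > 0\<close> prime]
  show "P = supported ?B"
  proof
    have "M \<subseteq> supported ?B"
    proof
      fix f
      assume f: "f \<in> M"
      then have "f \<in> P"
        using genideal_self[OF M(2)] M(3) by blast
      moreover obtain m where "f = Poly_Mapping.single m 1"
        using f M(1) by (auto simp: monomials_def)
      ultimately show "f \<in> supported ?B"
        using f M(2) iff[of m] by (auto simp: supported_single)
    qed
    moreover have "ideal (supported ?B) ?V"
      by (rule ideal_supported) (auto simp: veronese_exponents_zero veronese_exponents_add)
    ultimately show "P \<subseteq> supported ?B"
      using genideal_minimal M(3) by blast
    show "supported ?B \<subseteq> P"
    proof
      fix f :: "'f mpolynomial"
      assume f: "f \<in> supported ?B"
      show "f \<in> P"
      proof (rule add_closed_memI)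
        show "0 \<in> P"
          using additive_subgroup.zero_closed[OF is_additive_subgroup] by simp
        show "g + h \<in> P" if "g \<in> P" "h \<in> P" for g h
          using additive_subgroup.a_closed[OF is_additive_subgroup that] by simp
        fix m
        assume "m \<in> Poly_Mapping.keys f"
        then have "m \<in> ?B"
          using f by (auto simp: supported_def)
        then have "Poly_Mapping.single m 1 \<in> P"
          using iff by simp
        then show "Poly_Mapping.single m (Poly_Mapping.lookup f m) \<in> P"
          using I_l_closed[of "Poly_Mapping.single m 1" "Poly_Mapping.single 0 (Poly_Mapping.lookup f m)"]
          by (simp add: supported_single veronese_exponents_zero mult_single)
      qed
    qed
  qed
qed auto

text \<open>Every nonconstant monomial of the ring has positive \<open>T\<close>-weight here, so the
  ideal consists of the elements without constant term. Any strictly larger ideal is shown to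
  contain a nonzero constant.\<close>

lemma maximalideal_supported:
  assumes "{..<n} \<subseteq> T"
  shows "maximalideal (supported {m \<in> veronese_exponents n D. weight T m > 0})
    (poly_subring (veronese_exponents n D) :: ('f::field) mpolynomial ring)"
proof (rule maximalidealI)
  let ?A = "veronese_exponents n D"
  let ?B = "{m \<in> ?A. weight T m > 0}"
  let ?V = "poly_subring ?A :: 'f mpolynomial ring"
  show "ideal (supported ?B) ?V"
    by (rule ideal_supported) (auto simp: veronese_exponents_zero veronese_exponents_add)
  have "1 \<in> carrier ?V" "(1 :: 'f mpolynomial) \<notin> supported ?B"
    by (auto simp: supported_def veronese_exponents_zero)
  then show "carrier ?V \<noteq> supported ?B"
    by blast
  fix J :: "'f mpolynomial set"
  assume J: "ideal J ?V" "supported ?B \<subseteq> J" "J \<subseteq> carrier ?V"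
  interpret ideal J ?V by (rule J(1))
  show "J = supported ?B \<or> J = carrier ?V"
  proof (cases "J \<subseteq> supported ?B")
    case False
    then obtain f where f: "f \<in> J" "f \<notin> supported ?B"
      by blast
    have fA: "f \<in> supported ?A"
      using f(1) J(3) by auto
    let ?c = "Poly_Mapping.lookup f 0"
    \<comment> \<open>\<open>f + ?g\<close> is the constant \<open>?c\<close>, and \<open>?g\<close>
      has no constant term.\<close>
    let ?g = "Poly_Mapping.single 0 ?c - f"
    have pos: "m \<in> ?B" if "m \<in> ?A" "m \<noteq> 0" for m
    proof -
      have "Poly_Mapping.keys m \<inter> T \<noteq> {}"
        using that assms by (auto simp: veronese_exponents_def) (metis Int_absorb2 keys_eq_empty order_trans)
      then show ?thesis
        using that(1) by (simp add: weight_pos_iff)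
    qed
    have "?c \<noteq> 0"
    proof
      assume "?c = 0"
      then have "f \<in> supported ?B"
        using fA pos by (auto simp: supported_def in_keys_iff simp del: mem_Collect_eq)
      then show False
        using f(2) by blast
    qed
    have "?g \<in> supported ?B"
      unfolding supported_def mem_Collect_eq[of ?g]
    proof
      fix m
      assume "m \<in> Poly_Mapping.keys ?g"
      then have "m \<noteq> 0" "m \<in> Poly_Mapping.keys f"
        by (auto simp: in_keys_iff lookup_minus lookup_single when_def split: if_splits)
      then show "m \<in> ?B"
        using fA pos by (auto simp: supported_def)
    qed
    then have "Poly_Mapping.single 0 ?c \<in> J"
      using additive_subgroup.a_closed[OF is_additive_subgroup f(1), of ?g] J(2) by auto
    then have "1 \<in> J"
      using I_l_closed[of "Poly_Mapping.single 0 ?c" "Poly_Mapping.single 0 (1 / ?c)"] \<open>?c \<noteq> 0\<close>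
      by (simp add: supported_single veronese_exponents_zero mult_single)
    then show ?thesis
      using one_imp_carrier by simp
  qed (use J(2) in blast)
qed

section \<open>Ordinary and symbolic powers\<close>

text \<open>A monomial of \<open>P\<close> has positive degree divisible by \<open>D\<close>, so
  each factor adds at least \<open>1\<close> to the weight and \<open>D\<close> to the degree.
  Conversely, a monomial meeting both bounds for \<open>Suc r\<close> has a factor of degree
  \<open>D\<close> and positive weight whose cofactor meets them for \<open>r\<close>.\<close>

lemma ideal_pow_supported:
  assumes "D > 0"
  shows "ideal_pow (poly_subring (veronese_exponents n D) :: ('f::field) mpolynomial ring)
      (supported {m \<in> veronese_exponents n D. weight T m > 0}) r
    = supported {m \<in> veronese_exponents n D. weight T m \<ge> r \<and> monom_deg m \<ge> D * r}"
proof (induction r)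
  case 0
  show ?case
    by (simp add: ideal_pow_0)
next
  case (Suc r)
  let ?A = "veronese_exponents n D"
  let ?V = "poly_subring ?A :: 'f mpolynomial ring"
  let ?B = "{m \<in> ?A. weight T m > 0}"
  let ?C = "\<lambda>r. {m \<in> ?A. weight T m \<ge> r \<and> monom_deg m \<ge> D * r}"
  have "ideal_prod ?V (supported (?C r)) (supported ?B) = supported (?C (Suc r))"
  proof (intro equalityI subsetI)
    fix f
    assume "f \<in> ideal_prod ?V (supported (?C r)) (supported ?B)"
    then show "f \<in> supported (?C (Suc r))"
    proof (induction f rule: ideal_prod.induct)
      case (prod g h)
      have "a + b \<in> ?C (Suc r)" if "a \<in> ?C r" "b \<in> ?B" for a b
      proof -
        have "monom_deg b > 0" "D dvd monom_deg b"
          using that(2) by (auto simp: veronese_exponents_def monom_deg_split[of b T])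
        then have "monom_deg b \<ge> D"
          by (simp add: dvd_imp_le)
        then show ?thesis
          using that by (auto simp: veronese_exponents_add)
      qed
      then show ?case
        using prod by (auto intro: supported_mult)
    next
      case (sum g h)
      then show ?case
        by (simp add: supported_add)
    qed
  next
    fix f :: "'f mpolynomial"
    assume f: "f \<in> supported (?C (Suc r))"
    let ?I = "ideal_prod ?V (supported (?C r)) (supported ?B)"
    show "f \<in> ?I"
    proof (rule add_closed_memI)
      show "0 \<in> ?I"
        using ideal_prod.prod[of 0 "supported (?C r)" 0 "supported ?B" ?V] by (simp add: supported_zero)
      show "g + h \<in> ?I" if "g \<in> ?I" "h \<in> ?I" for g h
        using ideal_prod.sum[OF that] by simp
      fix m
      assume "m \<in> Poly_Mapping.keys f"
      then have m: "m \<in> ?A" "weight T m \<ge> Suc r" "monom_deg m \<ge> D * Suc r"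
        using f by (auto simp: supported_def)
      \<comment> \<open>The factor \<open>a\<close> of degree \<open>D\<close> takes as much
        \<open>T\<close>-weight as it can while leaving weight \<open>r\<close> to
        \<open>b\<close>.\<close>
      define t where "t = min D (weight T m - r)"
      have "r \<le> D * r"
        using assms by simp
      \<comment> \<open>This leaves degree \<open>D - t\<close> available outside \<open>T\<close>
        when \<open>t = weight T m - r\<close>; otherwise \<open>t = D\<close> and none is
        needed.\<close>
      then have "D + r \<le> weight T m + weight (- T) m"
        using m(3) monom_deg_split[of m T] \<open>r \<le> D * r\<close> unfolding mult_Suc_right by linarith
      then have "t \<le> weight T m" "D - t \<le> weight (- T) m"
        using m(2) by (auto simp: t_def)
      then obtain a b where ab: "m = a + b" "weight T a = t" "monom_deg a = t + (D - t)"
        using exists_factor by blast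
      have t: "0 < t" "t \<le> D" "t \<le> weight T m - r"
        using m(2) assms by (auto simp: t_def)
      have "a \<in> ?B"
        using m(1) ab t by (auto simp: veronese_exponents_def keys_add_nat)
      moreover have "b \<in> ?C r"
        using m ab t by (auto simp: veronese_exponents_def keys_add_nat)
      ultimately have "Poly_Mapping.single b (Poly_Mapping.lookup f m) \<otimes>\<^bsub>?V\<^esub> Poly_Mapping.single a 1 \<in> ?I"
        by (intro ideal_prod.prod) (auto simp: supported_single)
      then show "Poly_Mapping.single m (Poly_Mapping.lookup f m) \<in> ?I"
        by (simp add: mult_single ab(1) add.commute)
    qed
  qed
  then show ?case
    using Suc by (simp only: ideal_pow_Suc)
qed

text \<open>Least \<open>T\<close>-weights add under multiplication, and a polynomial of the ring
  outside \<open>P\<close> has a term of weight zero. Multiplying by it therefore leaves the least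
  weight of \<open>f\<close> unchanged.\<close>

lemma symbolic_power_supported:
  fixes P :: "('f::field) mpolynomial set"
  assumes "D > 0" and prime: "primeideal P (poly_subring (veronese_exponents n D))"
    and P: "P = supported {m \<in> veronese_exponents n D. weight T m > 0}"
    and j: "j < n" "j \<notin> T"
  shows "symbolic_power (poly_subring (veronese_exponents n D)) P E
    = supported {m \<in> veronese_exponents n D. weight T m \<ge> E}"
proof -
  let ?A = "veronese_exponents n D"
  let ?V = "poly_subring ?A :: 'f mpolynomial ring"
  let ?C = "{m \<in> ?A. weight T m \<ge> E \<and> monom_deg m \<ge> D * E}"
  have W: "\<Union>(associated_primes ?V P) = P"
    by (simp add: associated_primes_primeideal[OF prime])
  have pow: "ideal_pow ?V P E = supported ?C"
    unfolding P using \<open>D > 0\<close> by (rule ideal_pow_supported)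
  have symb: "symbolic_power ?V P E
      = {f \<in> supported ?A. \<exists>s \<in> supported ?A - P. s * f \<in> supported ?C}"
    unfolding symbolic_power_def W pow by simp
  show ?thesis
  proof (intro equalityI subsetI)
    fix f
    assume "f \<in> symbolic_power ?V P E"
    then obtain s where s: "f \<in> supported ?A" "s \<in> supported ?A" "s \<notin> P" "s * f \<in> supported ?C"
      unfolding symb by blast
    have "E \<le> weight T m" if m: "m \<in> Poly_Mapping.keys f" for m
    proof -
      obtain l where l: "l \<in> Poly_Mapping.keys f"
        and least: "\<And>m. m \<in> Poly_Mapping.keys f \<Longrightarrow> weight T l \<le> weight T m"
        using ex_has_least_nat[of "\<lambda>m. m \<in> Poly_Mapping.keys f" m "weight T"] m by blast
      have "\<exists>m \<in> Poly_Mapping.keys s. weight T m = 0"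
        using s(2,3) unfolding P by (auto simp: supported_def)
      then have "\<exists>m\<in>Poly_Mapping.keys (s * f). weight T m = 0 + weight T l"
        using l least by (intro exists_key_mult_of_least_weight) auto
      then have "E \<le> weight T l"
        using s(4) by (auto simp: supported_def)
      then show ?thesis
        using least[OF m] by simp
    qed
    then show "f \<in> supported {m \<in> ?A. weight T m \<ge> E}"
      using s(1) by (auto simp: supported_def)
  next
    fix f :: "'f mpolynomial"
    assume f: "f \<in> supported {m \<in> ?A. weight T m \<ge> E}"
    \<comment> \<open>The exponent \<open>D * E\<close> alone supplies the degree required in
      \<open>?C\<close>, whatever the degrees of the terms of \<open>f\<close>.\<close>
    let ?x = "Poly_Mapping.single j (D * E)"
    let ?s = "Poly_Mapping.single ?x 1 :: 'f mpolynomial"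
    have x: "?x \<in> ?A" "weight T ?x = 0" "monom_deg ?x = D * E"
      using j by (auto simp: veronese_exponents_def)
    have "?s \<in> supported {?x}"
      by (simp add: supported_single)
    then have "?s * f \<in> supported ?C"
      using f by (rule supported_mult) (use x in \<open>auto simp: veronese_exponents_add\<close>)
    moreover have "?s \<in> supported ?A" "?s \<notin> P"
      using x by (auto simp: supported_single P)
    moreover have "f \<in> supported ?A"
      using f by (auto simp: supported_def)
    ultimately show "f \<in> symbolic_power ?V P E"
      unfolding symb by blast
  qed
qed

section \<open>The containment criterion\<close>

theorem theorem5p4:
  fixes n D :: nat
    and P :: "((nat \<Rightarrow>\<^sub>0 nat) \<Rightarrow>\<^sub>0 'f::field) set"
  assumes "n \<ge> 2" and "D \<ge> 2"
    and "monomial_prime n D P"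
    and "P \<noteq> {\<zero>\<^bsub>veronese n D\<^esub>}"
    and "\<not> maximalideal P (veronese n D)"
  shows "(\<forall>E r :: nat. E > 0 \<longrightarrow> r > 0 \<longrightarrow>
            (symbolic_power (veronese n D) P E \<subseteq> ideal_pow (veronese n D) P r
              \<longleftrightarrow> int r \<le> \<lceil>real E / real D\<rceil>))
       \<and> (\<forall>r :: nat. r > 0 \<longrightarrow>
            symbolic_power (veronese n D) P (D * r)
              \<subseteq> symbolic_power (veronese n D) P (D * (r - 1) + 1)
          \<and> symbolic_power (veronese n D) P (D * (r - 1) + 1) \<subseteq> ideal_pow (veronese n D) P r
          \<and> (\<forall>r' > r. \<not> symbolic_power (veronese n D) P (D * (r - 1) + 1)
                          \<subseteq> ideal_pow (veronese n D) P r'))"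
proof -
  let ?A = "veronese_exponents n D"
  have D: "D > 0"
    using assms(2) by simp
  note V = veronese_eq[OF D, of n, where 'f = 'f]
  have prime: "primeideal P (poly_subring ?A)"
    using assms(3) by (simp add: monomial_prime_def V)
  obtain T where P: "P = supported {m \<in> ?A. weight T m > 0}" and T: "T \<subseteq> {..<n}"
    using monomial_prime_eq[OF D assms(3)] .
  \<comment> \<open>A set \<open>T\<close> containing every index below \<open>n\<close> would make
    \<open>P\<close> maximal.\<close>
  obtain j where j: "j < n" "j \<notin> T"
    using maximalideal_supported[of n T D] assms(5) by (auto simp: P V)
  obtain i where i: "i < n" "i \<in> T"
  proof -
    \<comment> \<open>With \<open>T\<close> empty no exponent has positive weight, and
      \<open>P\<close> would be zero.\<close>
    have "T \<noteq> {}"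
      using assms(4) by (auto simp: P V supported_def weight_def)
    then show ?thesis
      using that T by blast
  qed
  have symb: "symbolic_power (veronese n D) P E = supported {m \<in> ?A. weight T m \<ge> E}" for E
    unfolding V by (rule symbolic_power_supported[OF D prime P j])
  have pow: "ideal_pow (veronese n D) P r
      = supported {m \<in> ?A. weight T m \<ge> r \<and> monom_deg m \<ge> D * r}" for r
    unfolding V P by (rule ideal_pow_supported[OF D])
  have containment_iff: "symbolic_power (veronese n D) P E \<subseteq> ideal_pow (veronese n D) P (Suc r)
      \<longleftrightarrow> D * r < E" for E r
  proof
    assume sub: "symbolic_power (veronese n D) P E \<subseteq> ideal_pow (veronese n D) P (Suc r)"
    show "D * r < E"
    proof (rule ccontr)
      assume "\<not> D * r < E"
      \<comment> \<open>This monomial has weight and degree \<open>D * r\<close>: the weight is at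
        least \<open>E\<close>, while the degree falls short of \<open>D * Suc r\<close>.\<close>
      then have "(Poly_Mapping.single (Poly_Mapping.single i (D * r)) 1 :: 'f mpolynomial)
          \<in> symbolic_power (veronese n D) P E"
        using i by (auto simp: symb supported_single veronese_exponents_def)
      then have "(Poly_Mapping.single (Poly_Mapping.single i (D * r)) 1 :: 'f mpolynomial)
          \<in> ideal_pow (veronese n D) P (Suc r)"
        using sub by blast
      then show False
        using D by (simp add: pow supported_single)
    qed
  next
    assume less: "D * r < E"
    have "weight T m \<ge> Suc r \<and> monom_deg m \<ge> D * Suc r" if m: "m \<in> ?A" "weight T m \<ge> E" for m
    proof -
      obtain d where d: "monom_deg m = D * d"
        using m(1) by (auto simp: veronese_exponents_def)
      \<comment> \<open>The degree is at least the weight, hence above \<open>D * r\<close>; being a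
        multiple of \<open>D\<close>, it reaches \<open>D * Suc r\<close>. This is the source of the
        ceiling.\<close>
      have "D * r < D * d"
        using less m(2) monom_deg_split[of m T] d by linarith
      then have "Suc r \<le> d"
        by simp
      then have "D * Suc r \<le> D * d"
        by (rule mult_le_mono2)
      moreover have "r \<le> D * r"
        using D by simp
      ultimately show ?thesis
        using less m(2) d by linarith
    qed
    then show "symbolic_power (veronese n D) P E \<subseteq> ideal_pow (veronese n D) P (Suc r)"
      by (auto simp: symb pow supported_def)
  qed
  have ceiling: "int (Suc r) \<le> \<lceil>real E / real D\<rceil> \<longleftrightarrow> D * r < E" for E r
  proof -
    have "int (Suc r) \<le> \<lceil>real E / real D\<rceil> \<longleftrightarrow> real r < real E / real D"
      by (simp add: le_ceiling_iff)
    also have "\<dots> \<longleftrightarrow> real (D * r) < real E"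
      using D by (simp add: field_simps)
    finally show ?thesis
      by (simp only: of_nat_less_iff)
  qed
  show ?thesis
  proof (intro conjI allI impI)
    fix E r :: nat
    assume "r > 0"
    then obtain q where "r = Suc q"
      using gr0_implies_Suc by blast
    then show "symbolic_power (veronese n D) P E \<subseteq> ideal_pow (veronese n D) P r
        \<longleftrightarrow> int r \<le> \<lceil>real E / real D\<rceil>"
      by (simp only: containment_iff ceiling)
  next
    fix r :: nat
    assume "r > 0"
    then obtain q where q: "r = Suc q"
      using gr0_implies_Suc by blast
    show "symbolic_power (veronese n D) P (D * r)
        \<subseteq> symbolic_power (veronese n D) P (D * (r - 1) + 1)"
      using D by (auto simp: symb supported_def q)
    \<comment> \<open>Since \<open>r - 1 = q\<close>, this exponent is the least one above
      \<open>D * q\<close>.\<close>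
    show "symbolic_power (veronese n D) P (D * (r - 1) + 1) \<subseteq> ideal_pow (veronese n D) P r"
      by (simp add: containment_iff q)
    fix r'
    assume "r < r'"
    then obtain q' where q': "r' = Suc q'" "r \<le> q'"
      by (cases r') auto
    \<comment> \<open>Containment in the power \<open>Suc q'\<close> would require
      \<open>D * q' < D * q + 1\<close>, but \<open>q'\<close> is at least
      \<open>Suc q\<close>.\<close>
    have "D * Suc q \<le> D * q'"
      using q' q by (intro mult_le_mono2) simp
    then show "\<not> symbolic_power (veronese n D) P (D * (r - 1) + 1)
        \<subseteq> ideal_pow (veronese n D) P r'"
      using D q by (simp add: containment_iff q'(1))
  qed
qed

end
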